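(* $\mathfrak{b}(\mathbf{R}^{\mathrm{id}}_\forall)=\mathfrak{b}$ and $\mathfrak{d}(\mathbf{R}^{\mathrm{id}}_\forall)=\mathfrak{d}$, while $\mathfrak{b}(\mathbf{R}^{\mathrm{id}}_\exists)=\mathfrak{d}$ and $\mathfrak{d}(\mathbf{R}^{\mathrm{id}}_\exists)=\mathfrak{b}$.
   Context: A relational system $\mathbf{R}=\langle X,Y,\sqsubset\rangle$ consists of two non-empty sets $X,Y$ and a relation $\sqsubset$ between elements of $X$ and elements of $Y$. A set $F\subseteq X$ is $\mathbf{R}$-bounded if $\exists y\in Y\,\forall x\in F\; x\sqsubset y$, and $\mathbf{R}$-unbounded otherwise; $E\subseteq Y$ is $\mathbf{R}$-dominating if $\forall x\in X\,\exists y\in E\; x\sqsubset y$. Put $\mathfrak{b}(\mathbf{R})=\min\{|F|: F\subseteq X \text{ is } \mathbf{R}\text{-unbounded}\}$ and $\mathfrak{d}(\mathbf{R})=\min\{|D|: D\subseteq Y\text{ is }\mathbf{R}\text{-dominating}\}$. $\omega^{\uparrow\omega}$ is the set of strictly increasing functions $\omega\to\omega$; $[\omega]^\omega$ is the set of infinite subsets of $\omega$; $[a,b)=\{m\in\omega: a\le m<b\}$; $\forall^\infty n$ means "for all but finitely many $n\in\omega$", $\exists^\infty n$ means "for infinitely many $n\in\omega$". $\mathfrak{b}$ and $\mathfrak{d}$ denote $\mathfrak{b}(\mathbf{D})$ and $\mathfrak{d}(\mathbf{D})$ for $\mathbf{D}=\langle\omega^{\uparrow\omega},\omega^{\uparrow\omega},\le^*\rangle$,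 where $x\le^* y$ means $\forall^\infty n\; x(n)\le y(n)$. $\omega^{>\mathrm{id}}=\{f\in\omega^{\uparrow\omega}: f(n+1)-f(n)>n\text{ for all }n\}$. For $\iota\in\{\forall,\exists\}$, $\mathbf{R}^{\mathrm{id}}_\iota=\langle\omega^{>\mathrm{id}},[\omega]^\omega,\sqsubset^{\mathrm{id}}_\iota\rangle$, where $f\sqsubset^{\mathrm{id}}_\iota X$ iff $\iota^\infty n\; |[f(n),f(n+1))\cap X|\le n$. *)

theory Defs
  imports Main "HOL-Library.Infinite_Set"
begin

unbundle cardinal_syntax

record ('x, 'y) rel_sys =
  Lo :: "'x set"
  Hi :: "'y set"
  rl :: "'x \<Rightarrow> 'y \<Rightarrow> bool"

definition relational_system :: "('x, 'y) rel_sys \<Rightarrow> bool" where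
  "relational_system R \<longleftrightarrow> Lo R \<noteq> {} \<and> Hi R \<noteq> {}"

definition bounded_in :: "('x, 'y) rel_sys \<Rightarrow> 'x set \<Rightarrow> bool" where
  "bounded_in R F \<longleftrightarrow> (\<exists>y\<in>Hi R. \<forall>x\<in>F. rl R x y)"

definition dominating_in :: "('x, 'y) rel_sys \<Rightarrow> 'y set \<Rightarrow> bool" where
  "dominating_in R E \<longleftrightarrow> (\<forall>x\<in>Lo R. \<exists>y\<in>E. rl R x y)"

text \<open>
  The least cardinality of a member of a family of sets. Cardinals are well-orders, so this is
  determined only up to \<open>=o\<close>, and only if the family is nonempty (\<open>min_card_least\<close>); for the
  families used here, this is \<open>Rid_families_nonempty\<close> and \<open>Dsys_families_nonempty\<close>.
\<close>

definition min_card :: "'a set set \<Rightarrow> 'a rel" where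
  "min_card \<F> = (SOME r. r \<in> card_of ` \<F> \<and> (\<forall>B\<in>\<F>. r \<le>o |B| ))"

definition bnum :: "('x, 'y) rel_sys \<Rightarrow> 'x rel" where
  "bnum R = min_card {F. F \<subseteq> Lo R \<and> \<not> bounded_in R F}"

definition dnum :: "('x, 'y) rel_sys \<Rightarrow> 'y rel" where
  "dnum R = min_card {D. D \<subseteq> Hi R \<and> dominating_in R D}"

definition incr_fun :: "(nat \<Rightarrow> nat) set" where
  "incr_fun = {f. strict_mono f}"

definition Dsys :: "(nat \<Rightarrow> nat, nat \<Rightarrow> nat) rel_sys" where
  "Dsys = \<lparr>Lo = incr_fun, Hi = incr_fun, rl = (\<lambda>x y. \<forall>\<^sub>\<infinity>n. x n \<le> y n)\<rparr>"

definition fast_fun :: "(nat \<Rightarrow> nat) set" where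
  "fast_fun = {f \<in> incr_fun. \<forall>n. f (n + 1) - f n > n}"

text \<open>The parameter \<open>Q\<close> is the quantifier, to be instantiated by \<open>Alm_all\<close> or \<open>Inf_many\<close>.\<close>

definition Rid :: "((nat \<Rightarrow> bool) \<Rightarrow> bool) \<Rightarrow> (nat \<Rightarrow> nat, nat set) rel_sys" where
  "Rid Q = \<lparr>Lo = fast_fun, Hi = {A. infinite A},
            rl = (\<lambda>f A. Q (\<lambda>n. card ({f n..<f (n + 1)} \<inter> A) \<le> n))\<rparr>"

lemma min_card_least:
  assumes "\<F> \<noteq> {}"
  shows "\<exists>A\<in>\<F>. min_card \<F> = |A|" and "\<And>B. B \<in> \<F> \<Longrightarrow> min_card \<F> \<le>o |B|"
proof -
  have "\<exists>r\<in>card_of ` \<F>. \<forall>r'\<in>card_of ` \<F>. r \<le>o r'"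
    by (rule exists_minim_Card_order) (use assms card_of_Card_order in auto)
  then have "\<exists>r. r \<in> card_of ` \<F> \<and> (\<forall>B\<in>\<F>. r \<le>o |B| )"
    by auto
  then have *: "min_card \<F> \<in> card_of ` \<F> \<and> (\<forall>B\<in>\<F>. min_card \<F> \<le>o |B| )"
    unfolding min_card_def by (rule someI_ex)
  from * show "\<exists>A\<in>\<F>. min_card \<F> = |A|" by auto
  fix B assume "B \<in> \<F>" with * show "min_card \<F> \<le>o |B|" by auto
qed

lemma fast_fun_nonempty: "fast_fun \<noteq> {}"
proof -
  have "(\<lambda>n. n * n) \<in> fast_fun"
    by (auto simp: fast_fun_def incr_fun_def strict_mono_Suc_iff)
  then show ?thesis by auto
qed

lemma fast_range_small:
  assumes f: "f \<in> fast_fun"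
  shows "card ({f n..<f (n + 1)} \<inter> range f) \<le> 1"
proof -
  have "strict_mono f" using f by (simp add: fast_fun_def incr_fun_def)
  then have "{f n..<f (n + 1)} \<inter> range f \<subseteq> {f n}"
    by (auto simp: strict_mono_less strict_mono_less_eq less_Suc_eq)
  then have "card ({f n..<f (n + 1)} \<inter> range f) \<le> card {f n}"
    by (intro card_mono) auto
  then show ?thesis by simp
qed

lemma fast_fun_catches:
  assumes A: "infinite A"
  shows "\<exists>f\<in>fast_fun. \<forall>n. n < card ({f n..<f (n + 1)} \<inter> A)"
proof -
  have step: "\<exists>y. k < y \<and> n < y - k \<and> n < card ({k..<y} \<inter> A)" for k n :: nat
  proof -
    have "infinite (A - {..<k})" using A by (simp add: Diff_infinite_finite)
    then obtain B where B: "finite B" "card B = Suc n" "B \<subseteq> A - {..<k}"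
      by (meson infinite_arbitrarily_large)
    define y where "y = k + Suc n + Suc (Max B)"
    have "B \<subseteq> {k..<y} \<inter> A"
    proof
      fix b assume b: "b \<in> B"
      then have "b \<le> Max B" using B by simp
      moreover have "b \<in> A" "k \<le> b" using b B by auto
      ultimately show "b \<in> {k..<y} \<inter> A" by (simp add: y_def)
    qed
    then have "card B \<le> card ({k..<y} \<inter> A)" by (intro card_mono) auto
    with B show ?thesis by (intro exI[of _ y]) (auto simp: y_def)
  qed
  then obtain s where s: "\<And>k n. k < s k n \<and> n < s k n - k \<and> n < card ({k..<s k n} \<inter> A)"
    by metis
  define f where "f = rec_nat 0 (\<lambda>n k. s k n)"
  have f: "f (Suc n) = s (f n) n" for n by (simp add: f_def)
  have "f \<in> fast_fun"
    using s by (auto simp: fast_fun_def incr_fun_def strict_mono_Suc_iff f)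
  moreover have "\<forall>n. n < card ({f n..<f (n + 1)} \<inter> A)" using s by (simp add: f)
  ultimately show ?thesis by blast
qed

lemma relational_systems: "relational_system Dsys" "relational_system (Rid Q)"
  using fast_fun_nonempty infinite_UNIV_nat
  by (auto simp: relational_system_def Dsys_def Rid_def fast_fun_def)

lemma Rid_families_nonempty:
  assumes "Q = Alm_all \<or> Q = Inf_many"
  shows "{F. F \<subseteq> Lo (Rid Q) \<and> \<not> bounded_in (Rid Q) F} \<noteq> {}"
    and "{D. D \<subseteq> Hi (Rid Q) \<and> dominating_in (Rid Q) D} \<noteq> {}"
proof -
  have Qall: "Q P" if "\<And>n. n \<ge> 1 \<Longrightarrow> P n" for P
  proof -
    have "{n. \<not> P n} \<subseteq> {0}" using that by (auto simp: Suc_le_eq)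
    then have *: "\<forall>\<^sub>\<infinity>n. P n" by (auto simp: eventually_cofinite intro: finite_subset)
    then have "\<exists>\<^sub>\<infinity>n. P n" by (intro eventually_frequently) auto
    with * show ?thesis using assms by auto
  qed
  have Qnone: "\<not> Q P" if "\<And>n. \<not> P n" for P
    using assms that by (elim disjE) simp_all
  have "\<not> bounded_in (Rid Q) fast_fun"
  proof
    assume "bounded_in (Rid Q) fast_fun"
    then obtain A where A: "infinite A"
      "\<And>f. f \<in> fast_fun \<Longrightarrow> Q (\<lambda>n. card ({f n..<f (n + 1)} \<inter> A) \<le> n)"
      by (auto simp: bounded_in_def Rid_def)
    from fast_fun_catches[OF A(1)] obtain f where
      f: "f \<in> fast_fun" "\<And>n. n < card ({f n..<f (n + 1)} \<inter> A)" by blast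
    have "\<not> Q (\<lambda>n. card ({f n..<f (n + 1)} \<inter> A) \<le> n)"
      using f(2) by (intro Qnone) (simp add: not_le)
    with A(2)[OF f(1)] show False by blast
  qed
  then show "{F. F \<subseteq> Lo (Rid Q) \<and> \<not> bounded_in (Rid Q) F} \<noteq> {}"
    by (auto simp: Rid_def)
  have "\<exists>A. infinite A \<and> Q (\<lambda>n. card ({f n..<f (n + 1)} \<inter> A) \<le> n)"
    if f: "f \<in> fast_fun" for f
  proof (intro exI conjI)
    show "infinite (range f)" using f
      by (auto simp: fast_fun_def incr_fun_def strict_mono_imp_inj_on range_inj_infinite)
    show "Q (\<lambda>n. card ({f n..<f (n + 1)} \<inter> range f) \<le> n)"
      by (rule Qall) (use fast_range_small[OF f] order_trans in blast)
  qed
  then have "dominating_in (Rid Q) {A. infinite A}"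
    by (auto simp: dominating_in_def Rid_def)
  then show "{D. D \<subseteq> Hi (Rid Q) \<and> dominating_in (Rid Q) D} \<noteq> {}"
    by (auto simp: Rid_def)
qed

lemma Dsys_families_nonempty:
  "{F. F \<subseteq> Lo Dsys \<and> \<not> bounded_in Dsys F} \<noteq> {}"
  "{D. D \<subseteq> Hi Dsys \<and> dominating_in Dsys D} \<noteq> {}"
proof -
  have "\<not> (\<forall>\<^sub>\<infinity>n. Suc (y n) \<le> y n)" for y :: "nat \<Rightarrow> nat" by simp
  moreover have "(\<lambda>n. Suc (y n)) \<in> incr_fun" if "y \<in> incr_fun" for y
    using that by (simp add: incr_fun_def strict_mono_Suc_iff)
  ultimately have "\<not> bounded_in Dsys incr_fun"
    by (fastforce simp: bounded_in_def Dsys_def)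
  then show "{F. F \<subseteq> Lo Dsys \<and> \<not> bounded_in Dsys F} \<noteq> {}"
    by (auto simp: Dsys_def)
  have "dominating_in Dsys incr_fun"
    by (auto simp: dominating_in_def Dsys_def intro!: bexI)
  then show "{D. D \<subseteq> Hi Dsys \<and> dominating_in Dsys D} \<noteq> {}"
    by (auto simp: Dsys_def)
qed

end

theory Submission
  imports Defs
begin

text \<open>
  The cardinals \<open>bnum\<close> and \<open>dnum\<close> are invariant under Tukey equivalence and are exchanged by
  dualization, so it suffices to show that \<open>Rid Alm_all\<close> is Tukey equivalent to \<open>Dsys\<close>, and
  \<open>Rid Inf_many\<close> to its dual.

  A dominating function is turned into a sparse set by taking its range: if \<open>y\<close> is
  strictly increasing and \<open>f (n + 1) \<le> y n\<close>, then only \<open>y 0, \<dots>, y (n - 1)\<close> can lie below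
  \<open>f (n + 1)\<close>, so \<open>range y\<close> meets the \<open>n\<close>-th interval of \<open>f\<close> in at most \<open>n\<close> points
  (\<open>card_range_below\<close>). This argument treats one \<open>n\<close> at a time, hence serves both quantifiers.

  In the other direction the two quantifiers need different arguments. If almost every interval
  \<open>[f n, f (n + 1))\<close> has at most \<open>n\<close> points of \<open>A\<close>, adding up shows that \<open>A\<close> has at most
  \<open>n + n\<^sup>2\<close> points below \<open>f n\<close> for large \<open>n\<close>, so the point of \<open>A\<close> with index \<open>n + n\<^sup>2\<close> is an
  upper bound of \<open>f n\<close> (\<open>eventually_le_enumerate_of_thin\<close>). For infinitely many intervals argue
  contrapositively: choose \<open>y\<close> so that \<open>A\<close> has more than \<open>m\<close> points in \<open>[m, y m)\<close>. If \<open>x\<close>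
  dominates \<open>y\<close>, the \<open>n\<close>-th interval obtained by iterating \<open>x\<close> is, for large \<open>n\<close>, of the form
  \<open>[m, m')\<close> with \<open>m \<ge> n\<close> and \<open>m' \<ge> y m\<close>, and so contains more than \<open>n\<close> points of \<open>A\<close>
  (\<open>card_upto_enumerate_double\<close>).
\<close>

section \<open>Tukey connections and duality\<close>

definition tukey_le :: "('a, 'b) rel_sys \<Rightarrow> ('c, 'd) rel_sys \<Rightarrow> bool" where
  "tukey_le R S \<longleftrightarrow> (\<exists>\<phi> \<psi>. \<phi> ` Lo R \<subseteq> Lo S \<and> \<psi> ` Hi S \<subseteq> Hi R \<and>
     (\<forall>x\<in>Lo R. \<forall>y\<in>Hi S. rl S (\<phi> x) y \<longrightarrow> rl R x (\<psi> y)))"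

definition dual :: "('a, 'b) rel_sys \<Rightarrow> ('b, 'a) rel_sys" where
  "dual R = \<lparr>Lo = Hi R, Hi = Lo R, rl = (\<lambda>y x. \<not> rl R x y)\<rparr>"

lemma tukey_leI:
  assumes "\<And>x. x \<in> Lo R \<Longrightarrow> \<phi> x \<in> Lo S" and "\<And>y. y \<in> Hi S \<Longrightarrow> \<psi> y \<in> Hi R"
    and "\<And>x y. x \<in> Lo R \<Longrightarrow> y \<in> Hi S \<Longrightarrow> rl S (\<phi> x) y \<Longrightarrow> rl R x (\<psi> y)"
  shows "tukey_le R S"
  unfolding tukey_le_def using assms by (intro exI[of _ \<phi>] exI[of _ \<psi>]) auto

lemma tukey_leE:
  assumes "tukey_le R S"
  obtains \<phi> \<psi> where "\<And>x. x \<in> Lo R \<Longrightarrow> \<phi> x \<in> Lo S" and "\<And>y. y \<in> Hi S \<Longrightarrow> \<psi> y \<in> Hi R"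
    and "\<And>x y. x \<in> Lo R \<Longrightarrow> y \<in> Hi S \<Longrightarrow> rl S (\<phi> x) y \<Longrightarrow> rl R x (\<psi> y)"
proof -
  obtain \<phi> \<psi> where *: "\<phi> ` Lo R \<subseteq> Lo S \<and> \<psi> ` Hi S \<subseteq> Hi R \<and>
      (\<forall>x\<in>Lo R. \<forall>y\<in>Hi S. rl S (\<phi> x) y \<longrightarrow> rl R x (\<psi> y))"
    using assms unfolding tukey_le_def by (elim exE)
  show thesis by (rule that[of \<phi> \<psi>]) (use * in auto)
qed

lemma min_card_mono:
  assumes "\<G> \<noteq> {}" and "\<And>A. A \<in> \<G> \<Longrightarrow> \<exists>B\<in>\<F>. |B| \<le>o |A|"
  shows "min_card \<F> \<le>o min_card \<G>"
proof -
  obtain A where A: "A \<in> \<G>" "min_card \<G> = |A|"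
    using min_card_least(1)[OF assms(1)] by blast
  obtain B where B: "B \<in> \<F>" "|B| \<le>o |A|"
    using assms(2)[OF A(1)] by blast
  have "min_card \<F> \<le>o |B|"
    using B(1) by (intro min_card_least(2)) auto
  with B(2) A(2) show ?thesis
    using ordLeq_transitive by force
qed

text \<open>The \<open>Hi\<close> part of a connection carries dominating families to dominating families.\<close>

lemma tukey_le_dnum:
  assumes "tukey_le R S" and "{D. D \<subseteq> Hi S \<and> dominating_in S D} \<noteq> {}"
  shows "dnum R \<le>o dnum S"
  unfolding dnum_def
proof (rule min_card_mono[OF assms(2)])
  obtain \<phi> \<psi> where \<phi>: "\<And>x. x \<in> Lo R \<Longrightarrow> \<phi> x \<in> Lo S"
    and \<psi>: "\<And>y. y \<in> Hi S \<Longrightarrow> \<psi> y \<in> Hi R"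
    and conn: "\<And>x y. x \<in> Lo R \<Longrightarrow> y \<in> Hi S \<Longrightarrow> rl S (\<phi> x) y \<Longrightarrow> rl R x (\<psi> y)"
    by (rule tukey_leE[OF assms(1)]) (rule that; assumption)
  fix D assume "D \<in> {D. D \<subseteq> Hi S \<and> dominating_in S D}"
  then have D: "D \<subseteq> Hi S" "dominating_in S D" by auto
  have "dominating_in R (\<psi> ` D)"
    unfolding dominating_in_def
  proof
    fix x assume x: "x \<in> Lo R"
    then obtain y where "y \<in> D" "rl S (\<phi> x) y"
      using D(2) \<phi> unfolding dominating_in_def by blast
    then show "\<exists>y\<in>\<psi> ` D. rl R x y" using conn[OF x] D(1) by blast
  qed
  moreover have "\<psi> ` D \<subseteq> Hi R" using D(1) \<psi> by blast
  moreover have "|\<psi> ` D| \<le>o |D|" by (rule card_of_image)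
  ultimately show "\<exists>E\<in>{D. D \<subseteq> Hi R \<and> dominating_in R D}. |E| \<le>o |D|" by blast
qed

lemma unbounded_iff_dual_dominating: "\<not> bounded_in R F \<longleftrightarrow> dominating_in (dual R) F"
  by (simp add: bounded_in_def dominating_in_def dual_def)

lemma dual_dual [simp]: "dual (dual R) = R"
  by (simp add: dual_def)

lemma Hi_dual [simp]: "Hi (dual R) = Lo R" and Lo_dual [simp]: "Lo (dual R) = Hi R"
  by (simp_all add: dual_def)

lemma bnum_eq_dnum_dual: "bnum R = dnum (dual R)"
  by (simp add: bnum_def dnum_def unbounded_iff_dual_dominating)

lemma tukey_le_dual:
  assumes "tukey_le R S"
  shows "tukey_le (dual S) (dual R)"
proof -
  obtain \<phi> \<psi> where \<phi>: "\<And>x. x \<in> Lo R \<Longrightarrow> \<phi> x \<in> Lo S"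
    and \<psi>: "\<And>y. y \<in> Hi S \<Longrightarrow> \<psi> y \<in> Hi R"
    and conn: "\<And>x y. x \<in> Lo R \<Longrightarrow> y \<in> Hi S \<Longrightarrow> rl S (\<phi> x) y \<Longrightarrow> rl R x (\<psi> y)"
    by (rule tukey_leE[OF assms]) (rule that; assumption)
  show ?thesis
    by (rule tukey_leI[where \<phi> = \<psi> and \<psi> = \<phi>]) (use \<phi> \<psi> conn in \<open>auto simp: dual_def\<close>)
qed

lemma tukey_equiv_bnum_dnum:
  assumes "tukey_le R S" and "tukey_le S R"
    and "{F. F \<subseteq> Lo R \<and> \<not> bounded_in R F} \<noteq> {}" "{D. D \<subseteq> Hi R \<and> dominating_in R D} \<noteq> {}"
    and "{F. F \<subseteq> Lo S \<and> \<not> bounded_in S F} \<noteq> {}" "{D. D \<subseteq> Hi S \<and> dominating_in S D} \<noteq> {}"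
  shows "bnum R =o bnum S" and "dnum R =o dnum S"
proof -
  show "dnum R =o dnum S"
    using assms by (simp add: ordIso_iff_ordLeq tukey_le_dnum)
  show "bnum R =o bnum S"
    unfolding bnum_eq_dnum_dual
    using assms tukey_le_dual[OF assms(1)] tukey_le_dual[OF assms(2)]
    by (simp add: ordIso_iff_ordLeq tukey_le_dnum unbounded_iff_dual_dominating)
qed

section \<open>Sparse sets from dominating functions\<close>

lemma card_range_below:
  fixes y :: "nat \<Rightarrow> nat"
  assumes "strict_mono y" and "b \<le> y n"
  shows "card ({a..<b} \<inter> range y) \<le> n"
proof -
  have "{a..<b} \<inter> range y \<subseteq> y ` {..<n}"
  proof
    fix v assume "v \<in> {a..<b} \<inter> range y"
    then obtain k where k: "v = y k" "y k < b" by auto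
    with assms(2) have "y k < y n" by simp
    with assms(1) have "k < n" by (simp add: strict_mono_less)
    with k show "v \<in> y ` {..<n}" by blast
  qed
  then have "card ({a..<b} \<inter> range y) \<le> card (y ` {..<n})"
    by (intro card_mono) auto
  also have "\<dots> \<le> n" using card_image_le[of "{..<n}" y] by simp
  finally show ?thesis .
qed

text \<open>The shift lets \<open>y n\<close> be compared with the right end \<open>f (n + 1)\<close> of the \<open>n\<close>-th interval.\<close>

lemma tukey_le_Rid_Dsys: "tukey_le (Rid Alm_all) Dsys"
proof (rule tukey_leI[where \<phi> = "\<lambda>f n. f (Suc n)" and \<psi> = range])
  fix f assume "f \<in> Lo (Rid Alm_all)"
  then show "(\<lambda>n. f (Suc n)) \<in> Lo Dsys"
    by (simp add: Rid_def Dsys_def fast_fun_def incr_fun_def strict_mono_def)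
next
  fix y assume "y \<in> Hi Dsys"
  then show "range y \<in> Hi (Rid Alm_all)"
    by (simp add: Rid_def Dsys_def incr_fun_def strict_mono_imp_inj_on range_inj_infinite)
next
  fix f y assume "y \<in> Hi Dsys" and le: "rl Dsys (\<lambda>n. f (Suc n)) y"
  then have "strict_mono y" by (simp add: Dsys_def incr_fun_def)
  moreover have "\<forall>\<^sub>\<infinity>n. f (Suc n) \<le> y n" using le by (simp add: Dsys_def)
  ultimately show "rl (Rid Alm_all) f (range y)"
    by (auto simp: Rid_def elim!: eventually_mono intro: card_range_below)
qed

lemma tukey_le_Rid_dual_Dsys: "tukey_le (Rid Inf_many) (dual Dsys)"
proof (rule tukey_leI[where \<phi> = "\<lambda>f n. f (Suc n)" and \<psi> = range])
  fix f assume "f \<in> Lo (Rid Inf_many)"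
  then show "(\<lambda>n. f (Suc n)) \<in> Lo (dual Dsys)"
    by (simp add: Rid_def Dsys_def fast_fun_def incr_fun_def strict_mono_def)
next
  fix y assume "y \<in> Hi (dual Dsys)"
  then show "range y \<in> Hi (Rid Inf_many)"
    by (simp add: Rid_def Dsys_def incr_fun_def strict_mono_imp_inj_on range_inj_infinite)
next
  fix f y assume "y \<in> Hi (dual Dsys)" and not_le: "rl (dual Dsys) (\<lambda>n. f (Suc n)) y"
  then have "strict_mono y" by (simp add: Dsys_def incr_fun_def)
  moreover have "\<exists>\<^sub>\<infinity>n. f (Suc n) < y n"
    using not_le by (simp add: Dsys_def dual_def not_eventually linorder_not_le)
  ultimately show "rl (Rid Inf_many) f (range y)"
    by (auto simp: Rid_def elim!: frequently_elim1 intro: card_range_below)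
qed

section \<open>Dominating functions from sparse sets\<close>

text \<open>Otherwise the \<open>k + 1\<close> elements of \<open>A\<close> with indices \<open>0, \<dots>, k\<close> all lie below \<open>m\<close>.\<close>

lemma le_enumerate_of_card_le:
  fixes A :: "nat set"
  assumes "infinite A" and "card ({..<m} \<inter> A) \<le> k"
  shows "m \<le> enumerate A k"
proof (rule ccontr)
  assume "\<not> m \<le> enumerate A k"
  then have "enumerate A i < m" if "i \<le> k" for i
    using that assms(1) by (meson enumerate_mono_le_iff le_less_trans not_le)
  then have "enumerate A ` {..k} \<subseteq> {..<m} \<inter> A"
    using assms(1) by (auto simp: enumerate_in_set)
  then have "card (enumerate A ` {..k}) \<le> card ({..<m} \<inter> A)"
    by (intro card_mono) auto
  moreover have "card (enumerate A ` {..k}) = Suc k"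
    using assms(1) by (simp add: card_image strict_mono_enumerate strict_mono_imp_inj_on)
  ultimately show False using assms(2) by simp
qed

text \<open>
  The finitely many exceptional intervals end at some \<open>f N\<close> and contribute at most \<open>f N\<close> points,
  a constant that is absorbed once \<open>n \<ge> f N\<close>; the others contribute at most \<open>0 + \<dots> + (n - 1)\<close>,
  for which the crude bound \<open>n * n\<close> is enough.
\<close>

lemma eventually_le_enumerate_of_thin:
  fixes f :: "nat \<Rightarrow> nat"
  assumes f: "strict_mono f" and A: "infinite A"
    and thin: "\<forall>\<^sub>\<infinity>n. card ({f n..<f (Suc n)} \<inter> A) \<le> n"
  shows "\<forall>\<^sub>\<infinity>n. f n \<le> enumerate A (n + n * n)"
proof -
  obtain N where N: "\<And>n. n \<ge> N \<Longrightarrow> card ({f n..<f (Suc n)} \<inter> A) \<le> n"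
    using thin by (auto simp: MOST_nat_le)
  have count: "card ({..<f n} \<inter> A) \<le> f N + n * n" if "n \<ge> N" for n
    using that
  proof (induction n rule: dec_induct)
    case base
    have "card ({..<f N} \<inter> A) \<le> card {..<f N}" by (intro card_mono) auto
    then show ?case by simp
  next
    case (step n)
    have "f n < f (Suc n)" using f by (simp add: strict_mono_Suc_iff)
    then have "{..<f (Suc n)} \<inter> A = ({..<f n} \<inter> A) \<union> ({f n..<f (Suc n)} \<inter> A)" by auto
    then have "card ({..<f (Suc n)} \<inter> A)
        \<le> card ({..<f n} \<inter> A) + card ({f n..<f (Suc n)} \<inter> A)"
      by (simp add: card_Un_le)
    also have "\<dots> \<le> (f N + n * n) + n"
      using step.IH N[OF step.hyps(1)] by (rule add_mono)
    finally show ?case by simp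
  qed
  have "f n \<le> enumerate A (n + n * n)" if "n \<ge> N + f N" for n
    using that count[of n] by (intro le_enumerate_of_card_le[OF A]) simp
  then show ?thesis by (auto simp: MOST_nat_le)
qed

lemma fast_funI:
  assumes "\<And>n. f n + n < f (Suc n)"
  shows "f \<in> fast_fun"
proof -
  have "f n < f (Suc n)" "n < f (Suc n) - f n" for n
    using assms[of n] by simp_all
  then show ?thesis
    by (simp add: fast_fun_def incr_fun_def strict_mono_Suc_iff)
qed

text \<open>Adding squares makes the gaps larger than \<open>n\<close> and keeps the function above \<open>x\<close>, so an upper
  bound of the sum is also one of \<open>x\<close>.\<close>

lemma add_square_fast_fun:
  assumes "strict_mono x"
  shows "(\<lambda>n. x n + n * n) \<in> fast_fun"
proof (rule fast_funI)
  fix n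
  have "x n < x (Suc n)" using assms by (simp add: strict_mono_Suc_iff)
  then show "x n + n * n + n < x (Suc n) + Suc n * Suc n" by simp
qed

lemma tukey_le_Dsys_Rid: "tukey_le Dsys (Rid Alm_all)"
proof (rule tukey_leI[where \<phi> = "\<lambda>x n. x n + n * n" and \<psi> = "\<lambda>A n. enumerate A (n + n * n)"])
  fix x assume "x \<in> Lo Dsys"
  then show "(\<lambda>n. x n + n * n) \<in> Lo (Rid Alm_all)"
    by (simp add: Rid_def Dsys_def incr_fun_def add_square_fast_fun)
next
  fix A assume "A \<in> Hi (Rid Alm_all)"
  then have "infinite A" by (simp add: Rid_def)
  then show "(\<lambda>n. enumerate A (n + n * n)) \<in> Hi Dsys"
    by (simp add: Dsys_def incr_fun_def strict_mono_Suc_iff enumerate_mono)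
next
  fix x A
  assume x: "x \<in> Lo Dsys" and "A \<in> Hi (Rid Alm_all)"
    and thin: "rl (Rid Alm_all) (\<lambda>n. x n + n * n) A"
  then have "infinite A" by (simp add: Rid_def)
  moreover have "strict_mono (\<lambda>n. x n + n * n)"
    using x add_square_fast_fun[of x] by (simp add: Dsys_def incr_fun_def fast_fun_def)
  ultimately have "\<forall>\<^sub>\<infinity>n. x n + n * n \<le> enumerate A (n + n * n)"
    using thin by (intro eventually_le_enumerate_of_thin) (auto simp: Rid_def)
  then show "rl Dsys x (\<lambda>n. enumerate A (n + n * n))"
    by (auto simp: Dsys_def elim: eventually_mono)
qed

text \<open>The points of \<open>A\<close> with indices \<open>m, \<dots>, 2 * m\<close> are at least \<open>m\<close>, and there are \<open>m + 1\<close> of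
  them.\<close>

lemma card_upto_enumerate_double:
  fixes A :: "nat set"
  assumes "infinite A" and "Suc (enumerate A (2 * m)) \<le> b"
  shows "m < card ({m..<b} \<inter> A)"
proof -
  have "enumerate A ` {m..2 * m} \<subseteq> {m..<b} \<inter> A"
  proof
    fix v assume "v \<in> enumerate A ` {m..2 * m}"
    then obtain i where i: "v = enumerate A i" "m \<le> i" "i \<le> 2 * m" by auto
    have "i \<le> enumerate A i" using assms(1) by (rule le_enumerate)
    moreover have "enumerate A i \<le> enumerate A (2 * m)"
      using i(3) assms(1) by (simp add: enumerate_mono_le_iff)
    ultimately have "m \<le> enumerate A i" "enumerate A i < b"
      using i(2) assms(2) by linarith+
    then show "v \<in> {m..<b} \<inter> A"
      using i(1) assms(1) by (simp add: enumerate_in_set)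
  qed
  then have "card (enumerate A ` {m..2 * m}) \<le> card ({m..<b} \<inter> A)"
    by (intro card_mono) auto
  moreover have "card (enumerate A ` {m..2 * m}) = Suc m"
    using assms(1) by (simp add: card_image strict_mono_enumerate strict_mono_imp_inj_on)
  ultimately show ?thesis by simp
qed

text \<open>The summand \<open>n + 1\<close> only serves to make the iteration a member of \<open>fast_fun\<close>.\<close>

definition iterates :: "(nat \<Rightarrow> nat) \<Rightarrow> nat \<Rightarrow> nat" where
  "iterates x = rec_nat 0 (\<lambda>n m. x m + n + 1)"

lemma iterates_Suc: "iterates x (Suc n) = x (iterates x n) + n + 1"
  by (simp add: iterates_def)

lemma iterates_fast_fun:
  assumes "strict_mono x"
  shows "iterates x \<in> fast_fun"
proof (rule fast_funI)
  fix n
  show "iterates x n + n < iterates x (Suc n)"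
    using strict_mono_imp_increasing[OF assms, of "iterates x n"] by (simp add: iterates_Suc)
qed

lemma tukey_le_dual_Dsys_Rid: "tukey_le (dual Dsys) (Rid Inf_many)"
proof (rule tukey_leI[where \<phi> = iterates and \<psi> = "\<lambda>A m. Suc (enumerate A (2 * m))"])
  fix x assume "x \<in> Lo (dual Dsys)"
  then show "iterates x \<in> Lo (Rid Inf_many)"
    by (simp add: Dsys_def Rid_def incr_fun_def iterates_fast_fun)
next
  fix A assume "A \<in> Hi (Rid Inf_many)"
  then show "(\<lambda>m. Suc (enumerate A (2 * m))) \<in> Hi (dual Dsys)"
    by (simp add: Rid_def Dsys_def incr_fun_def strict_mono_Suc_iff enumerate_mono)
next
  fix x A
  assume x: "x \<in> Lo (dual Dsys)" and "A \<in> Hi (Rid Inf_many)"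
    and thin: "rl (Rid Inf_many) (iterates x) A"
  then have A: "infinite A" by (simp add: Rid_def)
  have "strict_mono (iterates x)"
    using x iterates_fast_fun[of x] by (simp add: Dsys_def incr_fun_def fast_fun_def)
  then have ge: "n \<le> iterates x n" for n by (rule strict_mono_imp_increasing)
  show "rl (dual Dsys) x (\<lambda>m. Suc (enumerate A (2 * m)))"
  proof (rule ccontr)
    assume "\<not> rl (dual Dsys) x (\<lambda>m. Suc (enumerate A (2 * m)))"
    then obtain N where N: "\<And>m. m \<ge> N \<Longrightarrow> Suc (enumerate A (2 * m)) \<le> x m"
      by (auto simp: dual_def Dsys_def MOST_nat_le)
    have "n < card ({iterates x n..<iterates x (n + 1)} \<inter> A)" if "n \<ge> N" for n
    proof -
      have "Suc (enumerate A (2 * iterates x n)) \<le> iterates x (n + 1)"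
        using N[of "iterates x n"] ge[of n] that by (simp add: iterates_Suc)
      from card_upto_enumerate_double[OF A this] ge[of n] show ?thesis by simp
    qed
    moreover have "\<exists>\<^sub>\<infinity>n. card ({iterates x n..<iterates x (n + 1)} \<inter> A) \<le> n"
      using thin by (simp add: Rid_def)
    ultimately show False by (meson INFM_nat_le not_le)
  qed
qed

section \<open>The cardinal invariants\<close>

theorem theoremE:
  shows "bnum (Rid Alm_all) =o bnum Dsys \<and> dnum (Rid Alm_all) =o dnum Dsys \<and>
         bnum (Rid Inf_many) =o dnum Dsys \<and> dnum (Rid Inf_many) =o bnum Dsys"
proof (intro conjI)
  show "bnum (Rid Alm_all) =o bnum Dsys" and "dnum (Rid Alm_all) =o dnum Dsys"
    using tukey_equiv_bnum_dnum[OF tukey_le_Rid_Dsys tukey_le_Dsys_Rid]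
      Rid_families_nonempty[of Alm_all] Dsys_families_nonempty by blast+
  have "{F. F \<subseteq> Lo (dual Dsys) \<and> \<not> bounded_in (dual Dsys) F} \<noteq> {}"
    "{D. D \<subseteq> Hi (dual Dsys) \<and> dominating_in (dual Dsys) D} \<noteq> {}"
    using Dsys_families_nonempty by (simp_all add: unbounded_iff_dual_dominating)
  then have "bnum (Rid Inf_many) =o bnum (dual Dsys)" "dnum (Rid Inf_many) =o dnum (dual Dsys)"
    using tukey_equiv_bnum_dnum[OF tukey_le_Rid_dual_Dsys tukey_le_dual_Dsys_Rid]
      Rid_families_nonempty[of Inf_many] by blast+
  then show "bnum (Rid Inf_many) =o dnum Dsys" and "dnum (Rid Inf_many) =o bnum Dsys"
    by (simp_all add: bnum_eq_dnum_dual)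
qed

end
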